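(* Let $0\le r\le n$, let $D\in\mathcal{D}_n$ be a Dyck path, and let $D'=\Phi_r(D)$. Then (1) $\#\{\text{tunnels of }D\text{ with midpoint at }x=n+r\}=\#\{\text{hills of }D'\text{ in }x>2r\}$; (2) $\#\{\text{tunnels of }D\text{ with midpoint in }x>n+r\}=\#\{\text{even rises of }D'\text{ in }x>2r\}$; (3) $\#\{\text{tunnels of }D\text{ with midpoint in }x\le n+r\}=\#\{\text{odd rises of }D'\text{ in }x>2r\}+\#\{\text{up-steps of }D'\text{ in }x\le 2r\}$; (4) $\#\{\text{multitunnels of }D\text{ with midpoint at }x=n+r\}=\#\{\text{arches of }D'\text{ in }x\ge 2r\}$.
   Context: A Dyck path of length $2n$ (semilength $n$) is a lattice path from $(0,0)$ to $(2n,0)$ consisting of up-steps $\mathbf{u}=(1,1)$ and down-steps $\mathbf{d}=(1,-1)$ that never goes below the $x$-axis; it is identified with its word in $\mathbf{u},\mathbf{d}$. $\mathcal{D}_n$ is the set of Dyck paths of length $2n$. Statistics and their $x$-coordinates. A hill is a peak ($\mathbf{u}$ immediately followed by $\mathbf{d}$) whose top has height $1$; its $x$-coordinate is that of the top of the peak. An odd (resp. even) rise is an up-step in an odd (resp. even) position when the steps are numbered $1,2,\dots$ from left to right. The $x$-coordinate of an up-step (in particular of an odd or even rise) is that of its rightmost end. An arch is a part of the path joining two consecutive points on the $x$-axis; its $x$-coordinate is that of its leftmost point. "In $x>2r$" etc. refers to these $x$-coordinates. A tunnel of $D$ is a decomposition $D=A\mathbf{u}B\mathbf{d}C$ with $B$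 a (possibly empty) Dyck path, viewed as the horizontal segment from the beginning of the displayed $\mathbf{u}$ to the end of the displayed $\mathbf{d}$. A multitunnel of $D$ is a decomposition $D=ABC$ with $B$ a nonempty Dyck path, viewed as the horizontal segment joining the initial and final points of $B$. Midpoints are those of these segments. The map $\Phi_r:\mathcal{D}_n\to\mathcal{D}_n$. In each tunnel decomposition $D=A\mathbf{u}B\mathbf{d}C$ the displayed $\mathbf{u}$ and $\mathbf{d}$ are called matched; this matches up-steps and down-steps bijectively. Given $D\in\mathcal{D}_n$, copy the first $2r$ steps of $D$ into the first $2r$ steps of $\Phi_r(D)$. Then read the remaining steps of $D$ in the zigzag order of positions $2r+1,\,2n,\,2r+2,\,2n-1,\,2r+3,\,2n-2,\dots$; for each of these steps in turn, if its matching step in $D$ has not yet been encountered (among the first $2r$ steps or the steps already read), append an up-step to $\Phi_r(D)$, otherwise append a down-step. The result is a Dyck path. *)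

theory Defs
  imports Complex_Main
begin

datatype step = Up | Down

type_synonym path = "step list"

fun rise :: "step \<Rightarrow> int" where
  "rise Up = 1"
| "rise Down = -1"

text \<open>\<open>height P x\<close> is the ordinate of the lattice path \<open>P\<close>, started at \<open>(0,0)\<close>, at abscissa
  \<open>x \<le> length P\<close>.\<close>

definition height :: "path \<Rightarrow> nat \<Rightarrow> int" where
  "height P x = (\<Sum>s\<leftarrow>take x P. rise s)"

definition dyck :: "path \<Rightarrow> bool" where
  "dyck P \<longleftrightarrow> (\<forall>x\<le>length P. height P x \<ge> 0) \<and> height P (length P) = 0"

definition Dyck_paths :: "nat \<Rightarrow> path set" where
  "Dyck_paths n = {P. dyck P \<and> length P = 2 * n}"

text \<open>Steps are numbered from 1, whereas list indices start at 0. The right end of the step in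
  position \<open>p\<close> has abscissa \<open>p\<close>.\<close>

definition step_at :: "path \<Rightarrow> nat \<Rightarrow> step" where
  "step_at P p = P ! (p - 1)"

text \<open>The statistics below are represented by the sets of their \<open>x\<close>-coordinates, except that an
  arch is given by the abscissae of both its ends.\<close>

definition up_steps :: "path \<Rightarrow> nat set" where
  "up_steps P = {x. 1 \<le> x \<and> x \<le> length P \<and> step_at P x = Up}"

definition odd_rises :: "path \<Rightarrow> nat set" where
  "odd_rises P = {x \<in> up_steps P. odd x}"

definition even_rises :: "path \<Rightarrow> nat set" where
  "even_rises P = {x \<in> up_steps P. even x}"

definition hills :: "path \<Rightarrow> nat set" where
  "hills P = {x. 1 \<le> x \<and> x < length P \<and> step_at P x = Up \<and> step_at P (x + 1) = Down
                 \<and> height P x = 1}"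

definition arches :: "path \<Rightarrow> (nat \<times> nat) set" where
  "arches P = {(x, y). x < y \<and> y \<le> length P \<and> height P x = 0 \<and> height P y = 0
                       \<and> (\<forall>z. x < z \<and> z < y \<longrightarrow> height P z \<noteq> 0)}"

definition tunnels :: "path \<Rightarrow> (path \<times> path \<times> path) set" where
  "tunnels P = {(A, B, C). P = A @ [Up] @ B @ [Down] @ C \<and> dyck B}"

definition multitunnels :: "path \<Rightarrow> (path \<times> path \<times> path) set" where
  "multitunnels P = {(A, B, C). P = A @ B @ C \<and> B \<noteq> [] \<and> dyck B}"

text \<open>The horizontal segment of a tunnel runs from \<open>x = length A\<close> to \<open>x = length A + length B + 2\<close>,
  that of a multitunnel from \<open>x = length A\<close> to \<open>x = length A + length B\<close>.\<close>

fun tunnel_midpoint :: "path \<times> path \<times> path \<Rightarrow> real" where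
  "tunnel_midpoint (A, B, C) = (real (length A) + real (length A + length B + 2)) / 2"

fun multitunnel_midpoint :: "path \<times> path \<times> path \<Rightarrow> real" where
  "multitunnel_midpoint (A, B, C) = (real (length A) + real (length A + length B)) / 2"

text \<open>\<open>matching P p q\<close>: the steps in positions \<open>p\<close> and \<open>q\<close> are the two displayed steps of one
  tunnel, in either order.\<close>

definition matching :: "path \<Rightarrow> nat \<Rightarrow> nat \<Rightarrow> bool" where
  "matching P p q \<longleftrightarrow> (\<exists>(A, B, C) \<in> tunnels P.
     {p, q} = {length A + 1, length A + length B + 2})"

text \<open>The order \<open>i, j, i + 1, j - 1, i + 2, \<dots>\<close> on the positions \<open>i, \<dots>, j\<close>.\<close>

function zigzag :: "nat \<Rightarrow> nat \<Rightarrow> nat list" where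
  "zigzag i j = (if i > j then [] else if i = j then [i] else i # j # zigzag (i + 1) (j - 1))"
  by pat_completeness auto
termination by (relation "measure (\<lambda>(i, j). j - i)") auto

declare zigzag.simps [simp del]

text \<open>\<open>read_steps P S ps\<close> reads the steps of \<open>P\<close> in the positions \<open>ps\<close>, where \<open>S\<close> is the set of
  positions encountered before.\<close>

fun read_steps :: "path \<Rightarrow> nat set \<Rightarrow> nat list \<Rightarrow> path" where
  "read_steps P S [] = []"
| "read_steps P S (p # ps) =
     (if \<exists>q\<in>S. matching P p q then Down else Up) # read_steps P (insert p S) ps"

definition Phi :: "nat \<Rightarrow> path \<Rightarrow> path" where
  "Phi r P = take (2 * r) P @ read_steps P {1..2 * r} (zigzag (2 * r + 1) (length P))"

end

theory Submission
  imports Defs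
begin

text \<open>
  Matching is a fixed-point-free involution on the positions of a Dyck path \<open>P\<close>. Reading all
  positions in some order, and writing \<open>Up\<close> for the first and \<open>Down\<close> for the second member of each
  matched pair, yields a path whose height at \<open>k\<close> is the number of steps among the first \<open>k\<close> read
  that still wait for their partner (\<open>height_read_steps\<close>). In particular the height is \<open>0\<close> exactly
  when the set of positions read so far is closed under matching. Since a prefix of \<open>P\<close> read from
  left to right reproduces itself, \<open>Phi r P\<close> is of this form, for the order
  \<open>1, \<dots>, 2r, 2r+1, 2n, 2r+2, 2n-1, \<dots>\<close>.

  The positions not yet read after \<open>2r + 2m\<close> steps form the interval from \<open>2r+m+1\<close> to \<open>2n-m\<close>, which
  is centred at \<open>x = n + r\<close>. An interval of positions is closed under matching if and only if
  its steps form a Dyck path, so the zeros of \<open>Phi r P\<close> at \<open>2r \<le> x < 2n\<close> are the multitunnels with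
  midpoint \<open>n + r\<close>; each of them is the left end of one arch. The first step taken from that
  interval is matched with the second one, that is, there is a tunnel with midpoint \<open>n + r\<close>,
  if and only if \<open>Phi r P\<close> has a hill there.

  Of two matched positions that are not symmetric about \<open>x = n + r\<close>, the one farther from this
  centre is read first. So the right end of a tunnel is read before the left end exactly when the
  midpoint lies to the right of \<open>n + r\<close>. Beyond the first \<open>2r\<close> steps the even steps of \<open>Phi r P\<close>
  come from the right of the centre, hence such tunnels correspond to the even rises. There are \<open>n\<close>
  tunnels of \<open>P\<close> and \<open>n\<close> up-steps of \<open>Phi r P\<close>, and the remaining tunnels are counted by subtraction.
\<close>

section \<open>Heights\<close>

lemma height_0 [simp]: "height P 0 = 0"
  by (simp add: height_def)

lemma height_Suc:
  assumes "x < length P"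
  shows "height P (Suc x) = height P x + rise (P ! x)"
  using assms by (simp add: height_def take_Suc_conv_app_nth)

lemma height_step:
  assumes "1 \<le> p" "p \<le> length P"
  shows "height P p = height P (p - 1) + rise (step_at P p)"
  using assms height_Suc[of "p - 1" P] by (simp add: step_at_def)

lemma height_up:
  assumes "1 \<le> p" "p \<le> length P" "step_at P p = Up"
  shows "height P p = height P (p - 1) + 1"
  using height_step[OF assms(1,2)] assms(3) by simp

lemma height_down:
  assumes "1 \<le> p" "p \<le> length P" "step_at P p = Down"
  shows "height P p = height P (p - 1) - 1"
  using height_step[OF assms(1,2)] assms(3) by simp

lemma not_Up_iff: "s \<noteq> Up \<longleftrightarrow> s = Down"
  by (cases s) auto

lemma height_factor:
  assumes "P = A @ B @ C" "k \<le> length B"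
  shows "height P (length A + k) = height P (length A) + height B k"
  using assms by (simp add: height_def)

lemma dyck_factor_iff:
  assumes "P = A @ B @ C"
  shows "dyck B \<longleftrightarrow> height P (length A + length B) = height P (length A) \<and>
           (\<forall>z. length A \<le> z \<and> z \<le> length A + length B \<longrightarrow> height P (length A) \<le> height P z)"
    (is "_ \<longleftrightarrow> ?R")
proof
  assume B: "dyck B"
  have "height P (length A) \<le> height P z" if "length A \<le> z" "z \<le> length A + length B" for z
    using B that height_factor[OF assms, of "z - length A"] by (auto simp: dyck_def)
  then show ?R
    using B height_factor[OF assms, of "length B"] by (simp add: dyck_def)
next
  assume R: ?R
  have "0 \<le> height B k" if "k \<le> length B" for k
    using R[THEN conjunct2, rule_format, of "length A + k"] that height_factor[OF assms that]
    by simp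
  then show "dyck B"
    using R height_factor[OF assms, of "length B"] by (simp add: dyck_def)
qed

lemma finite_up_steps [simp]: "finite (up_steps P)"
  by (rule finite_subset[of _ "{..length P}"]) (auto simp: up_steps_def)

lemma height_eq_card_up_steps:
  "x \<le> length P \<Longrightarrow> height P x = 2 * int (card {y \<in> up_steps P. y \<le> x}) - int x"
proof (induction x)
  case 0
  have "{y \<in> up_steps P. y \<le> 0} = {}" by (auto simp: up_steps_def)
  then show ?case by simp
next
  case (Suc x)
  show ?case
  proof (cases "step_at P (Suc x)")
    case Up
    have "{y \<in> up_steps P. y \<le> Suc x} = insert (Suc x) {y \<in> up_steps P. y \<le> x}"
      using Up Suc.prems by (auto simp: up_steps_def le_Suc_eq)
    then show ?thesis using Suc height_up[OF _ Suc.prems Up] by simp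
  next
    case Down
    have "{y \<in> up_steps P. y \<le> Suc x} = {y \<in> up_steps P. y \<le> x}"
      using Down by (auto simp: up_steps_def le_Suc_eq)
    then show ?thesis using Suc height_down[OF _ Suc.prems Down] by simp
  qed
qed

lemma card_up_steps:
  assumes "height P (length P) = 0"
  shows "2 * card (up_steps P) = length P"
proof -
  have "{y \<in> up_steps P. y \<le> length P} = up_steps P" by (auto simp: up_steps_def)
  then show ?thesis using height_eq_card_up_steps[of "length P" P] assms by simp
qed

lemma even_if_height_0:
  assumes "x \<le> length P" "height P x = 0"
  shows "even x"
  using height_eq_card_up_steps[OF assms(1)] assms(2) by presburger


section \<open>Tunnels, multitunnels and matched steps in terms of heights\<close>

text \<open>A tunnel is recorded by the positions \<open>p < q\<close> of its two displayed steps, so its segment runs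
  from \<open>x = p - 1\<close> to \<open>x = q\<close>; a multitunnel is recorded by the abscissae of its two ends.\<close>

definition tunnel_ends :: "path \<Rightarrow> (nat \<times> nat) set" where
  "tunnel_ends P = {(p, q). 1 \<le> p \<and> p < q \<and> q \<le> length P \<and> height P (p - 1) = height P q
                            \<and> (\<forall>z. p \<le> z \<and> z < q \<longrightarrow> height P q < height P z)}"

definition multitunnel_ends :: "path \<Rightarrow> (nat \<times> nat) set" where
  "multitunnel_ends P = {(a, b). a < b \<and> b \<le> length P \<and> height P a = height P b
                                 \<and> (\<forall>z. a \<le> z \<and> z \<le> b \<longrightarrow> height P a \<le> height P z)}"

lemma tunnel_ends_steps:
  assumes "(p, q) \<in> tunnel_ends P"
  shows "step_at P p = Up" "step_at P q = Down"
proof -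
  have pq: "1 \<le> p" "p < q" "q \<le> length P" "height P (p - 1) = height P q"
    and above: "\<And>z. p \<le> z \<Longrightarrow> z < q \<Longrightarrow> height P q < height P z"
    using assms by (auto simp: tunnel_ends_def)
  show "step_at P p = Up"
    using height_step[of p P] above[of p] pq by (cases "step_at P p") auto
  show "step_at P q = Down"
    using height_up[of q P] above[of "q - 1"] pq by (cases "step_at P q") force+
qed

lemma bij_betw_tunnels:
  "bij_betw (\<lambda>(A, B, C). (length A + 1, length A + length B + 2)) (tunnels P) (tunnel_ends P)"
proof (rule bij_betw_imageI)
  show "inj_on (\<lambda>(A, B, C). (length A + 1, length A + length B + 2)) (tunnels P)"
    by (auto simp: inj_on_def tunnels_def)
  show "(\<lambda>(A, B, C). (length A + 1, length A + length B + 2)) ` tunnels P = tunnel_ends P"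
  proof (intro equalityI subsetI)
    fix t assume "t \<in> (\<lambda>(A, B, C). (length A + 1, length A + length B + 2)) ` tunnels P"
    then obtain A B C where t: "t = (length A + 1, length A + length B + 2)"
      and P: "P = A @ [Up] @ B @ [Down] @ C" and B: "dyck B"
      by (auto simp: tunnels_def)
    have P': "P = (A @ [Up]) @ B @ ([Down] @ C)" using P by simp
    have up: "height P (length A + 1) = height P (length A) + 1"
      using height_up[of "length A + 1" P] P by (simp add: step_at_def nth_append)
    have eq: "height P (length A + 1 + length B) = height P (length A + 1)"
      and ge: "\<And>z. length A + 1 \<le> z \<Longrightarrow> z \<le> length A + 1 + length B
                 \<Longrightarrow> height P (length A + 1) \<le> height P z"
      using B dyck_factor_iff[OF P'] by auto
    have down: "height P (length A + length B + 2) = height P (length A + 1 + length B) - 1"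
      using height_down[of "length A + length B + 2" P] P by (simp add: step_at_def nth_append)
    show "t \<in> tunnel_ends P"
      using up eq down ge P unfolding t tunnel_ends_def by force
  next
    fix t assume t: "t \<in> tunnel_ends P"
    obtain p q where [simp]: "t = (p, q)" by force
    have pq: "1 \<le> p" "p < q" "q \<le> length P" "height P (p - 1) = height P q"
      and above: "\<And>z. p \<le> z \<Longrightarrow> z < q \<Longrightarrow> height P q < height P z"
      using t by (auto simp: tunnel_ends_def)
    define A B C where "A = take (p - 1) P" and "B = take (q - p - 1) (drop p P)"
      and "C = drop q P"
    have lens: "length A = p - 1" "length B = q - p - 1"
      using pq by (auto simp: A_def B_def)
    have "take p P = A @ [Up]"
      using take_Suc_conv_app_nth[of "p - 1" P] tunnel_ends_steps(1)[of p q P] t pq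
      by (simp add: A_def step_at_def)
    moreover have "take (q - 1) P = take p P @ B"
      using pq take_add[of p "q - p - 1" P] by (simp add: B_def)
    moreover have "take q P = take (q - 1) P @ [Down]"
      using take_Suc_conv_app_nth[of "q - 1" P] tunnel_ends_steps(2)[of p q P] t pq
      by (simp add: step_at_def)
    ultimately have P: "P = (A @ [Up]) @ B @ ([Down] @ C)"
      using append_take_drop_id[of q P] by (simp add: C_def)
    have up: "height P p = height P (p - 1) + 1" and down: "height P q = height P (q - 1) - 1"
      using height_up[of p P] height_down[of q P] tunnel_ends_steps[of p q P] t pq by auto
    have "dyck B"
      unfolding dyck_factor_iff[OF P] using lens pq up down above by force
    then have "(A, B, C) \<in> tunnels P" using P by (simp add: tunnels_def)
    moreover have "t = (\<lambda>(A, B, C). (length A + 1, length A + length B + 2)) (A, B, C)"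
      using lens pq by simp
    ultimately show "t \<in> (\<lambda>(A, B, C). (length A + 1, length A + length B + 2)) ` tunnels P"
      by blast
  qed
qed

lemma bij_betw_multitunnels:
  "bij_betw (\<lambda>(A, B, C). (length A, length A + length B)) (multitunnels P) (multitunnel_ends P)"
proof (rule bij_betw_imageI)
  show "inj_on (\<lambda>(A, B, C). (length A, length A + length B)) (multitunnels P)"
    by (auto simp: inj_on_def multitunnels_def)
  show "(\<lambda>(A, B, C). (length A, length A + length B)) ` multitunnels P = multitunnel_ends P"
  proof (intro equalityI subsetI)
    fix t assume "t \<in> (\<lambda>(A, B, C). (length A, length A + length B)) ` multitunnels P"
    then obtain A B C where t: "t = (length A, length A + length B)"
      and P: "P = A @ B @ C" and B: "dyck B" "B \<noteq> []"
      by (auto simp: multitunnels_def)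
    show "t \<in> multitunnel_ends P"
      using B dyck_factor_iff[OF P] P unfolding t multitunnel_ends_def by auto
  next
    fix t assume t: "t \<in> multitunnel_ends P"
    obtain a b where [simp]: "t = (a, b)" by force
    have ab: "a < b" "b \<le> length P" using t by (auto simp: multitunnel_ends_def)
    define A B C where "A = take a P" and "B = take (b - a) (drop a P)" and "C = drop b P"
    have lens: "length A = a" "length B = b - a" using ab by (auto simp: A_def B_def)
    have "take b P = A @ B"
      using ab take_add[of a "b - a" P] by (simp add: A_def B_def)
    then have P: "P = A @ B @ C"
      using append_take_drop_id[of b P] by (simp add: C_def)
    have "dyck B"
      unfolding dyck_factor_iff[OF P] using t ab lens by (auto simp: multitunnel_ends_def)
    then have "(A, B, C) \<in> multitunnels P" using P ab lens by (auto simp: multitunnels_def)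
    moreover have "t = (\<lambda>(A, B, C). (length A, length A + length B)) (A, B, C)"
      using lens ab by simp
    ultimately show "t \<in> (\<lambda>(A, B, C). (length A, length A + length B)) ` multitunnels P"
      by blast
  qed
qed

lemma card_Collect_via_bij_betw:
  assumes "bij_betw f A B" and "\<And>t. t \<in> A \<Longrightarrow> R t \<longleftrightarrow> f t \<in> S"
  shows "card {t \<in> A. R t} = card (B \<inter> S)"
proof (rule bij_betw_same_card[OF bij_betw_subset[OF assms(1)]])
  show "f ` {t \<in> A. R t} = B \<inter> S"
    using assms by (auto simp: bij_betw_def)
qed auto

lemma card_tunnels_midpoint:
  assumes "\<And>p q. R ((real p + real q - 1) / 2) \<longleftrightarrow> (p, q) \<in> S"
  shows "card {t \<in> tunnels P. R (tunnel_midpoint t)} = card (tunnel_ends P \<inter> S)"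
proof (rule card_Collect_via_bij_betw[OF bij_betw_tunnels], clarify)
  fix A B C :: path
  show "R (tunnel_midpoint (A, B, C)) \<longleftrightarrow> (length A + 1, length A + length B + 2) \<in> S"
    using assms[of "length A + 1" "length A + length B + 2"] by (simp add: add_ac)
qed

lemma card_multitunnels_midpoint:
  assumes "\<And>a b. R ((real a + real b) / 2) \<longleftrightarrow> (a, b) \<in> S"
  shows "card {t \<in> multitunnels P. R (multitunnel_midpoint t)} = card (multitunnel_ends P \<inter> S)"
proof (rule card_Collect_via_bij_betw[OF bij_betw_multitunnels], clarify)
  fix A B C :: path
  show "R (multitunnel_midpoint (A, B, C)) \<longleftrightarrow> (length A, length A + length B) \<in> S"
    using assms[of "length A" "length A + length B"] by simp
qed

lemma matching_iff: "matching P p q \<longleftrightarrow> (p, q) \<in> tunnel_ends P \<or> (q, p) \<in> tunnel_ends P"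
proof -
  let ?f = "\<lambda>(A :: path, B :: path, C :: path). (length A + 1, length A + length B + 2)"
  have "matching P p q \<longleftrightarrow> (\<exists>(a, b) \<in> ?f ` tunnels P. {p, q} = {a, b})"
    by (simp add: matching_def case_prod_unfold)
  also have "?f ` tunnels P = tunnel_ends P"
    using bij_betw_tunnels[of P] by (auto simp: bij_betw_def)
  finally show ?thesis by (auto simp: doubleton_eq_iff)
qed

lemma matching_sym: "matching P p q \<Longrightarrow> matching P q p"
  by (auto simp: matching_iff)

lemma matching_bounds:
  assumes "matching P p q"
  shows "p \<in> {1..length P}" "q \<in> {1..length P}" "p \<noteq> q"
  using assms by (auto simp: matching_iff tunnel_ends_def)

lemma matching_less_iff: "p < q \<Longrightarrow> matching P p q \<longleftrightarrow> (p, q) \<in> tunnel_ends P"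
  by (auto simp: matching_iff tunnel_ends_def)

lemma tunnel_ends_right_unique:
  assumes "(p, q) \<in> tunnel_ends P" "(p, q') \<in> tunnel_ends P"
  shows "q = q'"
proof -
  have *: False if "(p, q) \<in> tunnel_ends P" "(p, q') \<in> tunnel_ends P" "q < q'" for q q'
  proof -
    have "p \<le> q" using that by (simp add: tunnel_ends_def)
    then have "height P q' < height P q" using that unfolding tunnel_ends_def by blast
    then show False using that by (simp add: tunnel_ends_def)
  qed
  show ?thesis
    using *[OF assms] *[OF assms(2,1)] by (cases q q' rule: linorder_cases) auto
qed

lemma tunnel_ends_left_unique:
  assumes "(p, q) \<in> tunnel_ends P" "(p', q) \<in> tunnel_ends P"
  shows "p = p'"
proof -
  have *: False if "(p, q) \<in> tunnel_ends P" "(p', q) \<in> tunnel_ends P" "p < p'" for p p'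
  proof -
    have "p \<le> p' - 1" "p' - 1 < q" using that by (auto simp: tunnel_ends_def)
    then have "height P q < height P (p' - 1)" using that(1) by (auto simp: tunnel_ends_def)
    then show False using that(2) by (simp add: tunnel_ends_def)
  qed
  show ?thesis
    using *[OF assms] *[OF assms(2,1)] by (cases p p' rule: linorder_cases) auto
qed

lemma matching_unique:
  assumes "matching P p q" "matching P p q'"
  shows "q = q'"
  using assms tunnel_ends_left_unique tunnel_ends_right_unique tunnel_ends_steps
  by (metis matching_iff step.distinct(1))

text \<open>The partner of an up-step is the step with which the path first returns to the height from
  which that up-step started. The return takes place because the path ends at height \<open>0\<close>.\<close>

lemma tunnel_from_up:
  assumes "dyck P" "1 \<le> p" "p \<le> length P" "step_at P p = Up"
  obtains q where "(p, q) \<in> tunnel_ends P"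
proof -
  let ?below = "\<lambda>z. p < z \<and> height P z \<le> height P (p - 1)"
  have up: "height P p = height P (p - 1) + 1" by (rule height_up) fact+
  have "0 \<le> height P (p - 1)" "height P (length P) = 0"
    using assms by (auto simp: dyck_def)
  then have end_below: "?below (length P)"
    using up assms(3) by (metis order_le_less zle_add1_eq_le less_irrefl)
  define q where "q = (LEAST z. ?below z)"
  have q: "?below q" unfolding q_def by (rule LeastI[of ?below]) (rule end_below)
  have least: "q \<le> z" if "?below z" for z unfolding q_def by (rule Least_le) (rule that)
  have len: "q \<le> length P" using least end_below by blast
  have above: "height P (p - 1) < height P z" if "p \<le> z" "z < q" for z
    using least[of z] that up by (cases "z = p") (simp, meson le_neq_implies_less not_le)
  have "height P (q - 1) - 1 \<le> height P q"
    using height_step[of q P] q len by (cases "step_at P q") auto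
  then have "height P q = height P (p - 1)"
    using above[of "q - 1"] q by force
  then have "(p, q) \<in> tunnel_ends P"
    using assms q len above by (auto simp: tunnel_ends_def)
  then show thesis by (rule that)
qed

text \<open>Symmetrically, the partner of a down-step starts where the path last had, before
  the down-step, the height that the down-step reaches.\<close>

lemma tunnel_from_down:
  assumes "dyck P" "1 \<le> q" "q \<le> length P" "step_at P q = Down"
  obtains p where "(p, q) \<in> tunnel_ends P"
proof -
  let ?below = "\<lambda>z. z < q \<and> height P z \<le> height P q"
  have down: "height P q = height P (q - 1) - 1" by (rule height_down) fact+
  have start: "?below 0" using assms by (simp add: dyck_def)
  define a where "a = (GREATEST z. ?below z)"
  have a: "?below a" unfolding a_def by (rule GreatestI_nat[of ?below 0 q]) (use start in auto)
  have greatest: "z \<le> a" if "?below z" for z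
    unfolding a_def by (rule Greatest_le_nat[of ?below z q]) (use that in auto)
  have above: "height P q < height P z" if "a < z" "z < q" for z
    using greatest[of z] that by force
  have aq: "Suc a < q" using a down by (cases "Suc a = q") auto
  have "height P (Suc a) \<le> height P a + 1"
    using height_Suc[of a P] aq assms(3) by (cases "P ! a") auto
  then have "height P a = height P q"
    using above[of "Suc a"] a aq by force
  then have "(Suc a, q) \<in> tunnel_ends P"
    using aq assms above by (auto simp: tunnel_ends_def)
  then show thesis by (rule that)
qed

lemma matching_exists:
  assumes "dyck P" "p \<in> {1..length P}"
  obtains q where "matching P p q"
proof (cases "step_at P p")
  case Up
  with assms show thesis using tunnel_from_up that by (auto simp: matching_iff)
next
  case Down
  with assms show thesis using tunnel_from_down that by (auto simp: matching_iff)
qed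

text \<open>Each tunnel has one up-step, its left end, and each up-step starts one tunnel.\<close>

lemma card_tunnel_ends:
  assumes "dyck P"
  shows "2 * card (tunnel_ends P) = length P"
proof -
  have "bij_betw fst (tunnel_ends P) (up_steps P)"
  proof (rule bij_betw_imageI)
    show "inj_on fst (tunnel_ends P)"
      using tunnel_ends_right_unique by (force simp: inj_on_def)
    show "fst ` tunnel_ends P = up_steps P"
    proof (intro equalityI subsetI)
      fix p assume "p \<in> fst ` tunnel_ends P"
      then obtain q where pq: "(p, q) \<in> tunnel_ends P" by force
      then show "p \<in> up_steps P"
        using tunnel_ends_steps(1)[OF pq] by (auto simp: up_steps_def tunnel_ends_def)
    next
      fix p assume "p \<in> up_steps P"
      then obtain q where "(p, q) \<in> tunnel_ends P"
        using tunnel_from_up[OF assms] by (auto simp: up_steps_def)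
      then show "p \<in> fst ` tunnel_ends P" by force
    qed
  qed
  then show ?thesis
    using card_up_steps[of P] assms by (simp add: bij_betw_same_card dyck_def)
qed

lemma finite_tunnel_ends [simp]: "finite (tunnel_ends P)"
  by (rule finite_subset[of _ "{..length P} \<times> {..length P}"]) (auto simp: tunnel_ends_def)


section \<open>Sets of positions closed under matching\<close>

definition closed_under_matching :: "path \<Rightarrow> nat set \<Rightarrow> bool" where
  "closed_under_matching P S \<longleftrightarrow> (\<forall>p q. matching P p q \<longrightarrow> p \<in> S \<longrightarrow> q \<in> S)"

lemma closed_under_matching_Diff:
  assumes "closed_under_matching P S"
  shows "closed_under_matching P ({1..length P} - S)"
  using assms matching_bounds matching_sym unfolding closed_under_matching_def by blast

text \<open>If a tunnel had exactly one of its two steps inside a multitunnel, then an end of the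
  multitunnel would lie strictly between the ends of the tunnel and hence be strictly higher than
  the tunnel; but the tunnel has an end inside the multitunnel and so is not lower than it.
  Conversely, in an interval closed under matching, each down-step returns to a height already
  attained in the interval and each up-step leaves a height attained again in it; so by induction
  neither end lies above any point between them.\<close>

lemma closed_interval_iff_multitunnel:
  assumes "dyck P" "a < b" "b \<le> length P"
  shows "closed_under_matching P {a<..b} \<longleftrightarrow> (a, b) \<in> multitunnel_ends P"
proof
  assume ab: "(a, b) \<in> multitunnel_ends P"
  have "(p \<in> {a<..b} \<longleftrightarrow> q \<in> {a<..b})" if pq: "(p, q) \<in> tunnel_ends P" for p q
  proof -
    have above: "\<And>z. p \<le> z \<Longrightarrow> z < q \<Longrightarrow> height P q < height P z"
      and eq: "height P (p - 1) = height P q" and "p < q"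
      using pq by (auto simp: tunnel_ends_def)
    have low: "\<And>z. a \<le> z \<Longrightarrow> z \<le> b \<Longrightarrow> height P a \<le> height P z" and "height P a = height P b"
      using ab by (auto simp: multitunnel_ends_def)
    show ?thesis
    proof
      assume p: "p \<in> {a<..b}"
      then show "q \<in> {a<..b}"
        using above[of b] low[of "p - 1"] eq \<open>height P a = height P b\<close> \<open>p < q\<close> by force
    next
      assume q: "q \<in> {a<..b}"
      then show "p \<in> {a<..b}"
        using above[of a] low[of q] \<open>p < q\<close> by force
    qed
  qed
  then show "closed_under_matching P {a<..b}"
    by (auto simp: closed_under_matching_def matching_iff)
next
  assume cl: "closed_under_matching P {a<..b}"
  have inside: "p \<in> {a<..b} \<longleftrightarrow> q \<in> {a<..b}" if "(p, q) \<in> tunnel_ends P" for p q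
    using cl that unfolding closed_under_matching_def matching_iff by blast
  have from_left: "a \<le> z \<Longrightarrow> z \<le> b \<Longrightarrow> height P a \<le> height P z" for z
  proof (induction z rule: less_induct)
    case (less z)
    show ?case
    proof (cases "z = a")
      case False
      then have z: "a < z" "1 \<le> z" "z \<le> length P" using less.prems assms by auto
      show ?thesis
      proof (cases "step_at P z")
        case Up
        have "z - 1 < z" "a \<le> z - 1" "z - 1 \<le> b" using z less.prems by auto
        then show ?thesis using height_up[OF z(2,3) Up] less.IH[of "z - 1"] by simp
      next
        case Down
        then obtain p where p: "(p, z) \<in> tunnel_ends P"
          using tunnel_from_down[OF assms(1) z(2,3)] by blast
        then have "a < p" "p < z" "height P (p - 1) = height P z"
          using inside[OF p] z less.prems by (auto simp: tunnel_ends_def)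
        then show ?thesis using less.IH[of "p - 1"] less.prems by simp
      qed
    qed simp
  qed
  have from_right: "a \<le> z \<Longrightarrow> z \<le> b \<Longrightarrow> height P b \<le> height P z" for z
  proof (induction "b - z" arbitrary: z rule: less_induct)
    case less
    show ?case
    proof (cases "z = b")
      case False
      then have z: "z < b" "Suc z \<le> length P" using less.prems assms by auto
      show ?thesis
      proof (cases "step_at P (Suc z)")
        case Down
        then show ?thesis
          using height_down[OF _ z(2)] less.hyps[of "Suc z"] less.prems z
          by (simp add: diff_less_mono2)
      next
        case Up
        then obtain q where q: "(Suc z, q) \<in> tunnel_ends P"
          using tunnel_from_up[OF assms(1) _ z(2)] by auto
        then have "q \<le> b" "z < q" "height P z = height P q"
          using inside[OF q] z less.prems by (auto simp: tunnel_ends_def)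
        then show ?thesis using less.hyps[of q] less.prems by simp
      qed
    qed simp
  qed
  show "(a, b) \<in> multitunnel_ends P"
    using from_left order_antisym[OF from_left[of b] from_right[of a]] assms
    by (simp add: multitunnel_ends_def)
qed


section \<open>Reading a path in an arbitrary order\<close>

lemma length_read_steps [simp]: "length (read_steps P S ps) = length ps"
  by (induction ps arbitrary: S) auto

lemma read_steps_append:
  "read_steps P S (ps @ qs) = read_steps P S ps @ read_steps P (S \<union> set ps) qs"
  by (induction ps arbitrary: S) (auto simp: insert_commute)

lemma nth_read_steps:
  assumes "k < length ps"
  shows "read_steps P {} ps ! k = (if \<exists>q\<in>set (take k ps). matching P (ps ! k) q then Down else Up)"
proof -
  have "read_steps P {} ps
      = read_steps P {} (take k ps) @ read_steps P (set (take k ps)) (ps ! k # drop (Suc k) ps)"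
    using assms read_steps_append[of P "{}" "take k ps" "drop k ps"]
    by (simp add: Cons_nth_drop_Suc)
  then show ?thesis using assms by (simp add: nth_append)
qed

lemma step_at_read_steps:
  assumes "1 \<le> x" "x \<le> length ps"
  shows "step_at (read_steps P {} ps) x = Up
           \<longleftrightarrow> (\<forall>q. matching P (ps ! (x - 1)) q \<longrightarrow> q \<notin> set (take (x - 1) ps))"
  using assms by (auto simp: step_at_def nth_read_steps)

definition pending :: "path \<Rightarrow> nat set \<Rightarrow> nat set" where
  "pending P S = {p \<in> S. \<forall>q. matching P p q \<longrightarrow> q \<notin> S}"

text \<open>A step whose partner has been read takes that partner off the pending ones and is
  written as \<open>Down\<close>; any other step joins them and is written as \<open>Up\<close>.\<close>

lemma height_read_steps:
  assumes "distinct ps"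
  shows "k \<le> length ps \<Longrightarrow> height (read_steps P {} ps) k = int (card (pending P (set (take k ps))))"
proof (induction k)
  case 0
  then show ?case by (simp add: pending_def)
next
  case (Suc k)
  define S where "S = set (take k ps)"
  define p where "p = ps ! k"
  have S': "set (take (Suc k) ps) = insert p S"
    using Suc.prems by (simp add: take_Suc_conv_app_nth S_def p_def)
  have "p \<notin> S"
    using assms Suc.prems distinct_take[OF assms, of "Suc k"]
    by (simp add: take_Suc_conv_app_nth S_def p_def)
  have fin: "finite (pending P S)" by (simp add: pending_def S_def)
  show ?case
  proof (cases "\<exists>q\<in>S. matching P p q")
    case True
    then obtain q where q: "q \<in> S" "matching P p q" by blast
    then have "q \<in> pending P S"
      using matching_unique matching_sym \<open>p \<notin> S\<close> unfolding pending_def by blast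
    moreover have "pending P (insert p S) = pending P S - {q}"
      using q matching_unique matching_sym matching_bounds(3) \<open>p \<notin> S\<close> unfolding pending_def by blast
    ultimately have "card (pending P S) = Suc (card (pending P (insert p S)))"
      using fin card_Suc_Diff1 by metis
    then show ?thesis
      using Suc True S' height_Suc[of k "read_steps P {} ps"] nth_read_steps[of k ps P]
      by (simp add: S_def p_def)
  next
    case False
    then have "pending P (insert p S) = insert p (pending P S)"
      using matching_sym matching_bounds(3) unfolding pending_def by blast
    then have "card (pending P (insert p S)) = card (pending P S) + 1"
      using fin \<open>p \<notin> S\<close> by (simp add: pending_def)
    then show ?thesis
      using Suc False S' height_Suc[of k "read_steps P {} ps"] nth_read_steps[of k ps P]
      by (simp add: S_def p_def)
  qed
qed

lemma height_read_steps_eq_0_iff: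
  assumes "dyck P" "distinct ps" "set ps \<subseteq> {1..length P}" "k \<le> length ps"
  shows "height (read_steps P {} ps) k = 0 \<longleftrightarrow> closed_under_matching P (set (take k ps))"
proof -
  have "set (take k ps) \<subseteq> {1..length P}" using assms(3) set_take_subset[of k ps] by blast
  then have "pending P (set (take k ps)) = {} \<longleftrightarrow> closed_under_matching P (set (take k ps))"
    using matching_exists[OF assms(1)] matching_unique
    unfolding pending_def closed_under_matching_def by (smt (verit) Collect_empty_eq subsetD)
  moreover have "finite (pending P (set (take k ps)))" by (simp add: pending_def)
  ultimately show ?thesis
    using height_read_steps[OF assms(2,4), of P] by simp
qed

text \<open>From left to right the partner of a step has been read before it exactly if the step is
  \<open>Down\<close>. This is why the first \<open>2r\<close> steps, which are copied, also follow the reading rule.\<close>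

lemma read_steps_upt:
  assumes "dyck P" "k \<le> length P"
  shows "read_steps P {} [1..<Suc k] = take k P"
proof (rule nth_equalityI)
  show "length (read_steps P {} [1..<Suc k]) = length (take k P)" using assms by simp
  fix i assume "i < length (read_steps P {} [1..<Suc k])"
  then have i: "i < k" by (simp del: upt_Suc)
  have "(\<exists>q\<in>{1..<Suc i}. matching P (Suc i) q) \<longleftrightarrow> P ! i = Down"
  proof
    assume "\<exists>q\<in>{1..<Suc i}. matching P (Suc i) q"
    then obtain q where "q < Suc i" "matching P q (Suc i)" using matching_sym by auto
    then show "P ! i = Down"
      using tunnel_ends_steps(2)[of q "Suc i" P] by (simp add: matching_less_iff step_at_def)
  next
    assume "P ! i = Down"
    then obtain q where q: "(q, Suc i) \<in> tunnel_ends P"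
      using tunnel_from_down[OF assms(1), of "Suc i"] i assms(2) by (auto simp: step_at_def)
    then show "\<exists>q\<in>{1..<Suc i}. matching P (Suc i) q"
      by (intro bexI[of _ q]) (auto simp: matching_iff tunnel_ends_def)
  qed
  moreover have "set (take i [1..<Suc k]) = {1..<Suc i}" "[1..<Suc k] ! i = Suc i"
    using i by (auto simp: take_upt simp del: upt_Suc)
  ultimately show "read_steps P {} [1..<Suc k] ! i = take k P ! i"
    using i nth_read_steps[of i "[1..<Suc k]" P] by (cases "P ! i") (auto simp del: upt_Suc)
qed


section \<open>The zigzag order\<close>

lemma length_zigzag: "length (zigzag i j) = j + 1 - i"
  by (induction i j rule: zigzag.induct) (subst zigzag.simps, auto)

lemma nth_zigzag_even: "2 * m < j + 1 - i \<Longrightarrow> zigzag i j ! (2 * m) = i + m"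
proof (induction m arbitrary: i j)
  case 0
  then show ?case by (subst zigzag.simps) auto
next
  case (Suc m)
  then show ?case using Suc.IH[of "j - 1" "i + 1"] by (subst zigzag.simps) auto
qed

lemma nth_zigzag_odd: "2 * m + 1 < j + 1 - i \<Longrightarrow> zigzag i j ! (2 * m + 1) = j - m"
proof (induction m arbitrary: i j)
  case 0
  then show ?case by (subst zigzag.simps) auto
next
  case (Suc m)
  then show ?case using Suc.IH[of "j - 1" "i + 1"] by (subst zigzag.simps) auto
qed

lemma set_take_zigzag:
  "2 * m \<le> j + 1 - i \<Longrightarrow> 1 \<le> i \<Longrightarrow> set (take (2 * m) (zigzag i j)) = {i..<i + m} \<union> {j - m<..j}"
proof (induction m)
  case 0
  then show ?case by simp
next
  case (Suc m)
  have "take (2 * Suc m) (zigzag i j) = take (2 * m) (zigzag i j) @ [i + m, j - m]"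
    using Suc.prems nth_zigzag_even[of m j i] nth_zigzag_odd[of m j i]
    by (simp add: take_Suc_conv_app_nth length_zigzag)
  moreover have "set (take (2 * m) (zigzag i j)) = {i..<i + m} \<union> {j - m<..j}"
    using Suc by simp
  moreover have "{j - m<..j} \<union> {j - m} = {j - Suc m<..j}"
    using Suc.prems by auto
  ultimately show ?case by auto
qed

definition reading_order :: "nat \<Rightarrow> nat \<Rightarrow> nat list" where
  "reading_order r n = [1..<2 * r + 1] @ zigzag (2 * r + 1) (2 * n)"

context
  fixes r n :: nat
  assumes rn: "r \<le> n"
begin

lemma length_reading_order: "length (reading_order r n) = 2 * n"
  using rn by (simp add: reading_order_def length_zigzag del: upt_Suc)

lemma nth_reading_order_odd:
  "m < n - r \<Longrightarrow> reading_order r n ! (2 * r + 2 * m) = 2 * r + m + 1"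
  using nth_zigzag_even[of m "2 * n" "2 * r + 1"]
  by (simp add: reading_order_def nth_append del: upt_Suc)

lemma nth_reading_order_even:
  "m < n - r \<Longrightarrow> reading_order r n ! (2 * r + 2 * m + 1) = 2 * n - m"
  using nth_zigzag_odd[of m "2 * n" "2 * r + 1"]
  by (simp add: reading_order_def nth_append del: upt_Suc)

text \<open>The set is written as a complement because the unread positions form an interval.\<close>

lemma set_take_reading_order:
  assumes "m \<le> n - r"
  shows "set (take (2 * r + 2 * m) (reading_order r n)) = {1..2 * n} - {2 * r + m<..2 * n - m}"
  using assms rn set_take_zigzag[of m "2 * n" "2 * r + 1"]
  by (auto simp: reading_order_def simp del: upt_Suc)

lemma set_take_reading_order':
  assumes "m < n - r"
  shows "set (take (2 * r + 2 * m + 1) (reading_order r n))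
           = {1..2 * n} - {2 * r + m + 1<..2 * n - m}"
proof -
  have "take (2 * r + 2 * m + 1) (reading_order r n)
      = take (2 * r + 2 * m) (reading_order r n) @ [2 * r + m + 1]"
    using assms nth_reading_order_odd[of m]
    by (simp add: take_Suc_conv_app_nth length_reading_order)
  moreover have "{1..2 * n} - {2 * r + m<..2 * n - m} \<union> {2 * r + m + 1}
      = {1..2 * n} - {2 * r + m + 1<..2 * n - m}"
    using assms by auto
  ultimately show ?thesis using assms set_take_reading_order[of m] by simp
qed

lemma set_reading_order: "set (reading_order r n) = {1..2 * n}"
proof -
  have "2 * r + 2 * (n - r) = 2 * n" "2 * r + (n - r) = 2 * n - (n - r)" using rn by auto
  then show ?thesis
    using set_take_reading_order[of "n - r"] length_reading_order by simp
qed

lemma distinct_reading_order: "distinct (reading_order r n)"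
  by (rule card_distinct) (simp add: set_reading_order length_reading_order)

end

lemma Phi_eq_read_steps:
  assumes "r \<le> n" "P \<in> Dyck_paths n"
  shows "Phi r P = read_steps P {} (reading_order r n)"
proof -
  have "dyck P" "length P = 2 * n" using assms by (auto simp: Dyck_paths_def)
  moreover have "set [1..<2 * r + 1] = {1..2 * r}" by auto
  ultimately show ?thesis
    using read_steps_upt[of P "2 * r"] assms(1)
    unfolding Phi_def reading_order_def read_steps_append by simp
qed


section \<open>Comparing a path with its image\<close>

text \<open>What has been read is the complement of an interval; matching being symmetric, both are closed
  or neither is.\<close>

lemma closed_outside_iff_multitunnel:
  assumes "dyck P" "a < b" "b \<le> length P"
  shows "closed_under_matching P ({1..length P} - {a<..b}) \<longleftrightarrow> (a, b) \<in> multitunnel_ends P"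
proof -
  have "{1..length P} - ({1..length P} - {a<..b}) = {a<..b}" using assms(3) by auto
  then have "closed_under_matching P ({1..length P} - {a<..b}) \<longleftrightarrow> closed_under_matching P {a<..b}"
    using closed_under_matching_Diff by metis
  then show ?thesis using closed_interval_iff_multitunnel[OF assms] by simp
qed

context
  fixes r n :: nat and P :: path
  assumes rn: "r \<le> n" and P: "P \<in> Dyck_paths n"
begin

lemma dyck_P: "dyck P" and length_P: "length P = 2 * n"
  using P by (auto simp: Dyck_paths_def)

lemma length_Phi: "length (Phi r P) = 2 * n"
  using Phi_eq_read_steps[OF rn P] length_reading_order[OF rn] by simp

lemma height_Phi_eq_0_iff_closed:
  assumes "k \<le> 2 * n"
  shows "height (Phi r P) k = 0 \<longleftrightarrow> closed_under_matching P (set (take k (reading_order r n)))"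
  unfolding Phi_eq_read_steps[OF rn P]
  by (rule height_read_steps_eq_0_iff)
     (use assms rn dyck_P length_P in
       \<open>auto simp: distinct_reading_order length_reading_order set_reading_order\<close>)

lemma height_Phi_eq_0_iff:
  assumes "m < n - r"
  shows "height (Phi r P) (2 * r + 2 * m) = 0 \<longleftrightarrow> (2 * r + m, 2 * n - m) \<in> multitunnel_ends P"
  using assms height_Phi_eq_0_iff_closed[of "2 * r + 2 * m"] set_take_reading_order[OF rn, of m]
    closed_outside_iff_multitunnel[OF dyck_P, of "2 * r + m" "2 * n - m"]
  by (simp add: length_P)

lemma height_Phi_end: "height (Phi r P) (2 * n) = 0"
  using height_Phi_eq_0_iff_closed[of "2 * n"] length_reading_order[OF rn]
    set_reading_order[OF rn] matching_bounds(2)[of P] length_P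
  by (auto simp: closed_under_matching_def)

lemma step_at_Phi_odd:
  assumes "m < n - r"
  shows "step_at (Phi r P) (2 * r + 2 * m + 1) = Up
           \<longleftrightarrow> (\<forall>q. matching P (2 * r + m + 1) q \<longrightarrow> q \<in> {2 * r + m<..2 * n - m})"
proof -
  have "step_at (Phi r P) (2 * r + 2 * m + 1) = Up
          \<longleftrightarrow> (\<forall>q. matching P (2 * r + m + 1) q \<longrightarrow> q \<notin> {1..2 * n} - {2 * r + m<..2 * n - m})"
    using assms step_at_read_steps[of "2 * r + 2 * m + 1" "reading_order r n" P]
      nth_reading_order_odd[OF rn assms] set_take_reading_order[OF rn, of m]
    by (simp add: Phi_eq_read_steps[OF rn P] length_reading_order[OF rn])
  also have "\<dots> \<longleftrightarrow> (\<forall>q. matching P (2 * r + m + 1) q \<longrightarrow> q \<in> {2 * r + m<..2 * n - m})"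
    using matching_bounds(2) length_P by (metis DiffD2 DiffI)
  finally show ?thesis .
qed

lemma step_at_Phi_even:
  assumes "m < n - r"
  shows "step_at (Phi r P) (2 * r + 2 * m + 2) = Up
           \<longleftrightarrow> (\<forall>q. matching P (2 * n - m) q \<longrightarrow> q \<in> {2 * r + m + 1<..2 * n - m})"
proof -
  have "step_at (Phi r P) (2 * r + 2 * m + 2) = Up
          \<longleftrightarrow> (\<forall>q. matching P (2 * n - m) q \<longrightarrow> q \<notin> {1..2 * n} - {2 * r + m + 1<..2 * n - m})"
    using assms step_at_read_steps[of "2 * r + 2 * m + 2" "reading_order r n" P]
      nth_reading_order_even[OF rn assms] set_take_reading_order'[OF rn assms]
    by (simp add: Phi_eq_read_steps[OF rn P] length_reading_order[OF rn])
  also have "\<dots> \<longleftrightarrow> (\<forall>q. matching P (2 * n - m) q \<longrightarrow> q \<in> {2 * r + m + 1<..2 * n - m})"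
    using matching_bounds(2) length_P by (metis DiffD2 DiffI)
  finally show ?thesis .
qed

text \<open>When position \<open>2n - m\<close> is read, only the positions strictly between \<open>2r + m + 1\<close> and \<open>2n - m\<close>
  remain. A partner among them is smaller, so it is the left end of the tunnel.\<close>

lemma even_rise_Phi_iff:
  assumes "m < n - r"
  shows "step_at (Phi r P) (2 * r + 2 * m + 2) = Up
           \<longleftrightarrow> (\<exists>p. (p, 2 * n - m) \<in> tunnel_ends P \<and> 2 * r + m + 1 < p)"
proof -
  have "2 * n - m \<in> {1..length P}" using assms length_P by simp
  then obtain p where p: "matching P (2 * n - m) p"
    using matching_exists[OF dyck_P] by blast
  have "step_at (Phi r P) (2 * r + 2 * m + 2) = Up \<longleftrightarrow> p \<in> {2 * r + m + 1<..2 * n - m}"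
    using step_at_Phi_even[OF assms] p matching_unique by blast
  also have "\<dots> \<longleftrightarrow> (p, 2 * n - m) \<in> tunnel_ends P \<and> 2 * r + m + 1 < p"
    using p by (auto simp: matching_iff tunnel_ends_def)
  also have "\<dots> \<longleftrightarrow> (\<exists>p. (p, 2 * n - m) \<in> tunnel_ends P \<and> 2 * r + m + 1 < p)"
    using p matching_sym matching_unique by (metis matching_iff)
  finally show ?thesis .
qed

lemma multitunnel_of_tunnel:
  assumes "(p, q) \<in> tunnel_ends P"
  shows "(p - 1, q) \<in> multitunnel_ends P"
proof -
  have "height P q \<le> height P z" if "p - 1 \<le> z" "z \<le> q" for z
  proof (cases "z = p - 1 \<or> z = q")
    case False
    then have "p \<le> z" "z < q" using that by auto
    then show ?thesis using assms by (auto simp: tunnel_ends_def)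
  qed (use assms in \<open>auto simp: tunnel_ends_def\<close>)
  then show ?thesis using assms by (auto simp: tunnel_ends_def multitunnel_ends_def)
qed

text \<open>A hill starts at height \<open>0\<close>, so the steps left to be read are matched among themselves. The
  first one read waits for its partner; if the second one is written as \<open>Down\<close>, its partner
  has been read and lies in the same closed set, so it can only be the first one.\<close>

lemma hill_Phi_iff:
  assumes "m < n - r"
  shows "2 * r + 2 * m + 1 \<in> hills (Phi r P) \<longleftrightarrow> (2 * r + m + 1, 2 * n - m) \<in> tunnel_ends P"
proof -
  let ?x = "2 * r + 2 * m + 1" and ?p = "2 * r + m + 1" and ?q = "2 * n - m"
  have len: "?x < length (Phi r P)" "?p < ?q" using assms by (auto simp: length_Phi)
  show ?thesis
  proof
    assume tunnel: "(?p, ?q) \<in> tunnel_ends P"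
    then have match: "matching P ?p ?q" "matching P ?q ?p" by (auto simp: matching_iff)
    have "height (Phi r P) (?x - 1) = 0"
      using height_Phi_eq_0_iff[OF assms] multitunnel_of_tunnel[OF tunnel] by simp
    moreover have up: "step_at (Phi r P) ?x = Up"
      using step_at_Phi_odd[OF assms] match(1) matching_unique len(2) by force
    moreover have "step_at (Phi r P) (?x + 1) = Down"
      using step_at_Phi_even[OF assms] match(2) not_Up_iff by auto
    ultimately show "?x \<in> hills (Phi r P)"
      using height_up[of ?x "Phi r P"] len(1) by (simp add: hills_def)
  next
    assume hill: "?x \<in> hills (Phi r P)"
    then have "height (Phi r P) (2 * r + 2 * m) = 0"
      using height_up[of ?x "Phi r P"] by (simp add: hills_def)
    then have cl: "closed_under_matching P {2 * r + m<..?q}"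
      using height_Phi_eq_0_iff[OF assms] assms
        closed_interval_iff_multitunnel[OF dyck_P, of "2 * r + m" ?q] by (simp add: length_P)
    have "step_at (Phi r P) (2 * r + 2 * m + 2) \<noteq> Up" using hill by (simp add: hills_def)
    then obtain p where p: "matching P ?q p" "p \<notin> {2 * r + m + 1<..?q}"
      using step_at_Phi_even[OF assms] by blast
    moreover have "p \<in> {2 * r + m<..?q}"
      using cl p(1) len(2) unfolding closed_under_matching_def by force
    ultimately have "p = ?p" by auto
    then show "(?p, ?q) \<in> tunnel_ends P"
      using p(1) len(2) matching_sym matching_less_iff by blast
  qed
qed

text \<open>The segment of \<open>(p, q)\<close> has its midpoint at \<open>(p + q - 1) / 2\<close>, which gives the bounds on \<open>p + q\<close>
  below. The maps used send a pair to the abscissa in \<open>Phi r P\<close> at which its left or its right end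
  is read, \<open>m = 2n - q\<close> being the number of positions beyond \<open>q\<close>.\<close>

lemma card_central_tunnels:
  "card (tunnel_ends P \<inter> {(p, q). p + q = 2 * n + 2 * r + 1}) = card {x \<in> hills (Phi r P). x > 2 * r}"
proof (rule bij_betw_same_card[OF bij_betw_imageI])
  let ?f = "\<lambda>(p :: nat, q :: nat). 2 * r + 2 * (2 * n - q) + 1"
  let ?T = "tunnel_ends P \<inter> {(p, q). p + q = 2 * n + 2 * r + 1}"
  show "inj_on ?f ?T"
    by (auto simp: inj_on_def tunnel_ends_def length_P)
  show "?f ` ?T = {x \<in> hills (Phi r P). x > 2 * r}"
  proof (intro equalityI subsetI)
    fix x assume "x \<in> ?f ` ?T"
    then obtain p q where pq: "(p, q) \<in> tunnel_ends P" "p + q = 2 * n + 2 * r + 1"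
      and x: "x = 2 * r + 2 * (2 * n - q) + 1" by auto
    have "p < q" "q \<le> 2 * n" using pq by (auto simp: tunnel_ends_def length_P)
    then have "2 * n - q < n - r" "2 * r + (2 * n - q) + 1 = p" "2 * n - (2 * n - q) = q"
      using pq(2) by auto
    then show "x \<in> {x \<in> hills (Phi r P). x > 2 * r}"
      using hill_Phi_iff[of "2 * n - q"] pq(1) x by simp
  next
    fix x assume "x \<in> {x \<in> hills (Phi r P). x > 2 * r}"
    then have hill: "x \<in> hills (Phi r P)" and x: "2 * r < x" "x < 2 * n"
      by (auto simp: hills_def length_Phi)
    have "height (Phi r P) (x - 1) = 0"
      using hill height_up[of x "Phi r P"] by (simp add: hills_def)
    then have "even (x - 1)" using even_if_height_0[of "x - 1" "Phi r P"] x by (simp add: length_Phi)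
    define m where "m = (x - 2 * r) div 2"
    have m: "x = 2 * r + 2 * m + 1"
      using x \<open>even (x - 1)\<close> unfolding m_def by presburger
    have "m < n - r" using m x by simp
    then show "x \<in> ?f ` ?T"
      using hill hill_Phi_iff[of m] m by (intro image_eqI[of _ _ "(2 * r + m + 1, 2 * n - m)"]) auto
  qed
qed

lemma card_right_tunnels:
  "card (tunnel_ends P \<inter> {(p, q). p + q > 2 * n + 2 * r + 1})
     = card {x \<in> even_rises (Phi r P). x > 2 * r}"
proof (rule bij_betw_same_card[OF bij_betw_imageI])
  let ?f = "\<lambda>(p :: nat, q :: nat). 2 * r + 2 * (2 * n - q) + 2"
  let ?T = "tunnel_ends P \<inter> {(p, q). p + q > 2 * n + 2 * r + 1}"
  have bound: "q \<le> 2 * n" if "(p, q) \<in> tunnel_ends P" for p q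
    using that by (auto simp: tunnel_ends_def length_P)
  show "inj_on ?f ?T"
  proof (rule inj_onI, clarify)
    fix p q p' q'
    assume *: "(p, q) \<in> tunnel_ends P" "(p', q') \<in> tunnel_ends P"
      "2 * r + 2 * (2 * n - q) + 2 = 2 * r + 2 * (2 * n - q') + 2"
    then have "q = q'" using bound[of p q] bound[of p' q'] by simp
    then show "p = p' \<and> q = q'" using * tunnel_ends_left_unique by blast
  qed
  show "?f ` ?T = {x \<in> even_rises (Phi r P). x > 2 * r}"
  proof (intro equalityI subsetI)
    fix x assume "x \<in> ?f ` ?T"
    then obtain p q where pq: "(p, q) \<in> tunnel_ends P" "p + q > 2 * n + 2 * r + 1"
      and x: "x = 2 * r + 2 * (2 * n - q) + 2" by auto
    have "p < q" "q \<le> 2 * n" using pq bound by (auto simp: tunnel_ends_def)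
    then have "2 * n - q < n - r" "2 * r + (2 * n - q) + 1 < p" "2 * n - (2 * n - q) = q"
      using pq(2) by auto
    then show "x \<in> {x \<in> even_rises (Phi r P). x > 2 * r}"
      using even_rise_Phi_iff[of "2 * n - q"] pq(1) x
      by (auto simp: even_rises_def up_steps_def length_Phi)
  next
    fix x assume "x \<in> {x \<in> even_rises (Phi r P). x > 2 * r}"
    then have up: "step_at (Phi r P) x = Up" and x: "2 * r < x" "x \<le> 2 * n" "even x"
      by (auto simp: even_rises_def up_steps_def length_Phi)
    define m where "m = (x - 2 * r - 2) div 2"
    have m: "x = 2 * r + 2 * m + 2" "m < n - r" using x unfolding m_def by presburger+
    then obtain p where "(p, 2 * n - m) \<in> tunnel_ends P" "2 * r + m + 1 < p"
      using even_rise_Phi_iff[of m] up by auto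
    then show "x \<in> ?f ` ?T"
      using m by (intro image_eqI[of _ _ "(p, 2 * n - m)"]) auto
  qed
qed

lemma card_arches_right:
  "card {(x, y) \<in> arches (Phi r P). x \<ge> 2 * r}
     = card {x. 2 * r \<le> x \<and> x < 2 * n \<and> height (Phi r P) x = 0}"
proof (rule bij_betw_same_card[OF bij_betw_imageI])
  let ?A = "{(x, y) \<in> arches (Phi r P). x \<ge> 2 * r}"
  show "inj_on fst ?A"
  proof (rule inj_onI, clarsimp)
    fix x y y' assume "(x, y) \<in> arches (Phi r P)" "(x, y') \<in> arches (Phi r P)"
    then show "y = y'" by (cases y y' rule: linorder_cases) (auto simp: arches_def)
  qed
  show "fst ` ?A = {x. 2 * r \<le> x \<and> x < 2 * n \<and> height (Phi r P) x = 0}"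
  proof (intro equalityI subsetI)
    fix x assume "x \<in> fst ` ?A"
    then show "x \<in> {x. 2 * r \<le> x \<and> x < 2 * n \<and> height (Phi r P) x = 0}"
      by (auto simp: arches_def length_Phi)
  next
    fix x assume x: "x \<in> {x. 2 * r \<le> x \<and> x < 2 * n \<and> height (Phi r P) x = 0}"
    let ?zero = "\<lambda>y. x < y \<and> height (Phi r P) y = 0"
    define y where "y = (LEAST y. ?zero y)"
    have end_zero: "?zero (2 * n)" using x height_Phi_end by simp
    have y: "?zero y" unfolding y_def by (rule LeastI[of ?zero]) (rule end_zero)
    have "y \<le> 2 * n" unfolding y_def by (rule Least_le) (rule end_zero)
    moreover have "\<forall>z. x < z \<and> z < y \<longrightarrow> height (Phi r P) z \<noteq> 0"
      using not_less_Least[of _ ?zero] unfolding y_def by blast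
    ultimately have "(x, y) \<in> ?A" using x y by (auto simp: arches_def length_Phi)
    then show "x \<in> fst ` ?A" by force
  qed
qed

lemma card_central_multitunnels:
  "card (multitunnel_ends P \<inter> {(a, b). a + b = 2 * n + 2 * r})
     = card {x. 2 * r \<le> x \<and> x < 2 * n \<and> height (Phi r P) x = 0}"
proof (rule bij_betw_same_card[OF bij_betw_imageI])
  let ?f = "\<lambda>(a :: nat, b :: nat). 2 * r + 2 * (2 * n - b)"
  let ?T = "multitunnel_ends P \<inter> {(a, b). a + b = 2 * n + 2 * r}"
  show "inj_on ?f ?T"
    by (auto simp: inj_on_def multitunnel_ends_def length_P)
  show "?f ` ?T = {x. 2 * r \<le> x \<and> x < 2 * n \<and> height (Phi r P) x = 0}"
  proof (intro equalityI subsetI)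
    fix x assume "x \<in> ?f ` ?T"
    then obtain a b where ab: "(a, b) \<in> multitunnel_ends P" "a + b = 2 * n + 2 * r"
      and x: "x = 2 * r + 2 * (2 * n - b)" by auto
    have "a < b" "b \<le> 2 * n" using ab by (auto simp: multitunnel_ends_def length_P)
    then have "2 * n - b < n - r" "2 * r + (2 * n - b) = a" "2 * n - (2 * n - b) = b"
      using ab(2) by auto
    then show "x \<in> {x. 2 * r \<le> x \<and> x < 2 * n \<and> height (Phi r P) x = 0}"
      using height_Phi_eq_0_iff[of "2 * n - b"] ab(1) x by simp
  next
    fix x assume "x \<in> {x. 2 * r \<le> x \<and> x < 2 * n \<and> height (Phi r P) x = 0}"
    then have x: "2 * r \<le> x" "x < 2 * n" and zero: "height (Phi r P) x = 0" by auto
    then have "even x" using even_if_height_0[of x "Phi r P"] by (simp add: length_Phi)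
    define m where "m = (x - 2 * r) div 2"
    have m: "x = 2 * r + 2 * m" "m < n - r"
      using x \<open>even x\<close> unfolding m_def by presburger+
    then show "x \<in> ?f ` ?T"
      using zero height_Phi_eq_0_iff[of m]
      by (intro image_eqI[of _ _ "(2 * r + m, 2 * n - m)"]) auto
  qed
qed

text \<open>By complementation: there are as many tunnels as up-steps of \<open>Phi r P\<close>.\<close>

lemma card_left_tunnels:
  "card (tunnel_ends P \<inter> {(p, q). p + q \<le> 2 * n + 2 * r + 1})
     = card {x \<in> odd_rises (Phi r P). x > 2 * r} + card {x \<in> up_steps (Phi r P). x \<le> 2 * r}"
proof -
  let ?L = "tunnel_ends P \<inter> {(p, q). p + q \<le> 2 * n + 2 * r + 1}"
  let ?R = "tunnel_ends P \<inter> {(p, q). p + q > 2 * n + 2 * r + 1}"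
  let ?E = "{x \<in> even_rises (Phi r P). x > 2 * r}"
  let ?O = "{x \<in> odd_rises (Phi r P). x > 2 * r}"
  let ?I = "{x \<in> up_steps (Phi r P). x \<le> 2 * r}"
  have "tunnel_ends P = ?L \<union> ?R" by auto
  then have "card (tunnel_ends P) = card (?L \<union> ?R)" by simp
  also have "\<dots> = card ?L + card ?R" by (rule card_Un_disjoint) auto
  finally have tunnels: "card ?L + card ?R = n"
    using card_tunnel_ends[OF dyck_P] length_P by simp
  have fin: "finite ?E" "finite ?O" "finite ?I"
    by (auto simp: even_rises_def odd_rises_def)
  have "up_steps (Phi r P) = (?O \<union> ?I) \<union> ?E" by (auto simp: even_rises_def odd_rises_def)
  then have "card (up_steps (Phi r P)) = card ((?O \<union> ?I) \<union> ?E)" by simp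
  also have "\<dots> = card (?O \<union> ?I) + card ?E"
    using fin by (intro card_Un_disjoint) (auto simp: even_rises_def odd_rises_def)
  also have "card (?O \<union> ?I) = card ?O + card ?I"
    using fin by (intro card_Un_disjoint) auto
  finally have "card ?O + card ?I + card ?E = n"
    using card_up_steps[of "Phi r P"] height_Phi_end by (simp add: length_Phi)
  then show ?thesis using tunnels card_right_tunnels by simp
qed

end

theorem theorem5:
  fixes n r :: nat and D D' :: path
  assumes "r \<le> n" and "D \<in> Dyck_paths n" and "D' = Phi r D"
  shows "(card {t \<in> tunnels D. tunnel_midpoint t = real (n + r)}
           = card {x \<in> hills D'. x > 2 * r}) \<and>
         (card {t \<in> tunnels D. tunnel_midpoint t > real (n + r)}
           = card {x \<in> even_rises D'. x > 2 * r}) \<and>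
         (card {t \<in> tunnels D. tunnel_midpoint t \<le> real (n + r)}
           = card {x \<in> odd_rises D'. x > 2 * r} + card {x \<in> up_steps D'. x \<le> 2 * r}) \<and>
         (card {t \<in> multitunnels D. multitunnel_midpoint t = real (n + r)}
           = card {(x, y) \<in> arches D'. x \<ge> 2 * r})"
proof (intro conjI)
  show "card {t \<in> tunnels D. tunnel_midpoint t = real (n + r)} = card {x \<in> hills D'. x > 2 * r}"
    unfolding assms(3) card_central_tunnels[OF assms(1,2), symmetric]
    by (rule card_tunnels_midpoint) auto
  show "card {t \<in> tunnels D. tunnel_midpoint t > real (n + r)}
          = card {x \<in> even_rises D'. x > 2 * r}"
    unfolding assms(3) card_right_tunnels[OF assms(1,2), symmetric]
    by (rule card_tunnels_midpoint) auto
  show "card {t \<in> tunnels D. tunnel_midpoint t \<le> real (n + r)}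
          = card {x \<in> odd_rises D'. x > 2 * r} + card {x \<in> up_steps D'. x \<le> 2 * r}"
    unfolding assms(3) card_left_tunnels[OF assms(1,2), symmetric]
    by (rule card_tunnels_midpoint) auto
  show "card {t \<in> multitunnels D. multitunnel_midpoint t = real (n + r)}
          = card {(x, y) \<in> arches D'. x \<ge> 2 * r}"
    unfolding assms(3) card_arches_right[OF assms(1,2)] card_central_multitunnels[OF assms(1,2), symmetric]
    by (rule card_multitunnels_midpoint) auto
qed

end
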